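(* Let $(M,J,g)$ be a non-integrable metallic pseudo-Riemannian manifold and let $\nabla$ be a torsion-free linear connection on $M$. Assume that $(\nabla,g)$ is Codazzi-coupled. Then $(M,J,g)$ is a quasi metallic pseudo-Riemannian manifold if and only if $$g\big((\nabla_XJ)Y,Z\big)+g\big((\nabla_YJ)Z,X\big)+g\big((\nabla_ZJ)X,Y\big)=0$$ for all vector fields $X,Y,Z$ on $M$.
   Context: $X,Y,Z$ denote arbitrary smooth vector fields on $M$. A metallic structure on a smooth manifold $M$ is a $(1,1)$-tensor field $J$, which is a bundle isomorphism $TM\to TM$, such that $J^2=pJ+qI$ for some real numbers $p,q$ ($I$ the identity). A metallic pseudo-Riemannian manifold $(M,J,g)$ is a pseudo-Riemannian manifold $(M,g)$ with a metallic structure $J$ that is $g$-symmetric: $g(JX,Y)=g(X,JY)$. $J$ is integrable if its Nijenhuis tensor $N_J(X,Y)=[JX,JY]-J[JX,Y]-J[X,JY]+J^2[X,Y]$ vanishes; $(M,J,g)$ is non-integrable if $J$ is not integrable. The pair $(\nabla,g)$ is Codazzi-coupled if $(\nabla_Xg)(Y,Z)=(\nabla_Zg)(X,Y)$ for all $X,Y,Z$. The Tachibana operator applied to $g$ is $$(\Phi_Jg)(X,Y,Z)=(JX)\big(g(Y,Z)\big)-X\big(g(JY,Z)\big)+g\big((L_YJ)X,Z\big)+g\big(Y,(L_ZJ)X\big),$$ where $(L_XJ)Y=[X,JY]-J[X,Y]$. A non-integrable metallic pseudo-Riemannian manifold $(M,J,g)$ is called a quasi metallic pseudo-Riemannian manifold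 if $(\Phi_Jg)(X,Y,Z)+(\Phi_Jg)(Y,Z,X)+(\Phi_Jg)(Z,X,Y)=0$ for all $X,Y,Z$. *)

theory Defs
  imports "HOL-Analysis.Analysis" "HOL-Library.Function_Algebras"
begin

section \<open>Smooth manifolds\<close>

text \<open>Meant for open \<open>S\<close>: the directional derivatives along all fixed vectors \<open>v\<close> exist and are
  continuous up to order \<open>k\<close>.\<close>

primrec C_on :: "nat \<Rightarrow> 'e::euclidean_space set \<Rightarrow> ('e \<Rightarrow> 'b::real_normed_vector) \<Rightarrow> bool" where
  "C_on 0 S f \<longleftrightarrow> continuous_on S f"
| "C_on (Suc k) S f \<longleftrightarrow> (\<forall>x\<in>S. f differentiable (at x)) \<and>
     (\<forall>v. C_on k S (\<lambda>x. frechet_derivative f (at x) v))"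

definition smooth_on :: "'e::euclidean_space set \<Rightarrow> ('e \<Rightarrow> 'b::real_normed_vector) \<Rightarrow> bool" where
  "smooth_on S f \<longleftrightarrow> (\<forall>k. C_on k S f)"

text \<open>A chart is a pair \<open>(U, \<phi>)\<close> of a domain and a coordinate map; the atlas need not be maximal.\<close>

record ('a, 'e) manifold =
  topology_of :: "'a topology"
  atlas :: "('a set \<times> ('a \<Rightarrow> 'e)) set"

abbreviation points :: "('a, 'e, 'z) manifold_scheme \<Rightarrow> 'a set" where
  "points M \<equiv> topspace (topology_of M)"

definition smooth_manifold :: "('a, 'e::euclidean_space) manifold \<Rightarrow> bool" where
  "smooth_manifold M \<longleftrightarrow>
     Hausdorff_space (topology_of M) \<and> second_countable (topology_of M) \<and>
     (\<Union>(U, \<phi>)\<in>atlas M. U) = points M \<and>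
     (\<forall>(U, \<phi>)\<in>atlas M. openin (topology_of M) U \<and> open (\<phi> ` U) \<and>
        homeomorphic_map (subtopology (topology_of M) U) (top_of_set (\<phi> ` U)) \<phi>) \<and>
     (\<forall>(U, \<phi>)\<in>atlas M. \<forall>(V, \<psi>)\<in>atlas M. smooth_on (\<phi> ` (U \<inter> V)) (\<psi> \<circ> inv_into U \<phi>))"

text \<open>Functions on \<open>M\<close> are represented by total functions whose values outside \<open>points M\<close> are
  irrelevant.\<close>

definition smooth_functions :: "('a, 'e::euclidean_space) manifold \<Rightarrow> ('a \<Rightarrow> real) set" where
  "smooth_functions M = {f. \<forall>(U, \<phi>)\<in>atlas M. smooth_on (\<phi> ` U) (f \<circ> inv_into U \<phi>)}"


section \<open>Tangent vectors and vector fields\<close>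

text \<open>Tangent vectors at \<open>p\<close> are derivations at \<open>p\<close> of the algebra of smooth functions. They are
  normalised to vanish on non-smooth arguments, so that equality of functionals is equality of
  derivations. No condition is needed for arguments that agree on \<open>points M\<close>: if \<open>f\<close> vanishes
  there, then \<open>f = f * h\<close> with \<open>h\<close> the indicator function of the complement, so the Leibniz rule
  gives \<open>v f = 0\<close>.\<close>

type_synonym 'a tangent = "('a \<Rightarrow> real) \<Rightarrow> real"
type_synonym 'a vfield = "'a \<Rightarrow> 'a tangent"

definition scale :: "real \<Rightarrow> 'a tangent \<Rightarrow> 'a tangent" where
  "scale c v = (\<lambda>f. c * v f)"

definition tangent_space :: "('a, 'e::euclidean_space) manifold \<Rightarrow> 'a \<Rightarrow> 'a tangent set" where
  "tangent_space M p = {v.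
     (\<forall>f\<in>smooth_functions M. \<forall>h\<in>smooth_functions M. v (f + h) = v f + v h) \<and>
     (\<forall>c. \<forall>f\<in>smooth_functions M. v (\<lambda>x. c * f x) = c * v f) \<and>
     (\<forall>f\<in>smooth_functions M. \<forall>h\<in>smooth_functions M. v (f * h) = v f * h p + f p * v h) \<and>
     (\<forall>f. f \<notin> smooth_functions M \<longrightarrow> v f = 0)}"

definition dir_deriv :: "'a vfield \<Rightarrow> ('a \<Rightarrow> real) \<Rightarrow> 'a \<Rightarrow> real" where
  "dir_deriv X f = (\<lambda>p. X p f)"

definition fscale :: "('a \<Rightarrow> real) \<Rightarrow> 'a vfield \<Rightarrow> 'a vfield" where
  "fscale f X = (\<lambda>p. scale (f p) (X p))"

text \<open>Sums, differences and zero of vector fields are the pointwise ones. Vector fields are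
  normalised to vanish outside \<open>points M\<close>.\<close>

definition vector_fields :: "('a, 'e::euclidean_space) manifold \<Rightarrow> 'a vfield set" where
  "vector_fields M = {X.
     (\<forall>p\<in>points M. X p \<in> tangent_space M p) \<and> (\<forall>p. p \<notin> points M \<longrightarrow> X p = 0) \<and>
     (\<forall>f\<in>smooth_functions M. dir_deriv X f \<in> smooth_functions M)}"

definition bracket :: "'a vfield \<Rightarrow> 'a vfield \<Rightarrow> 'a vfield" where
  "bracket X Y = (\<lambda>p f. dir_deriv X (dir_deriv Y f) p - dir_deriv Y (dir_deriv X f) p)"


section \<open>Tensor fields\<close>

type_synonym 'a endo_field = "'a \<Rightarrow> 'a tangent \<Rightarrow> 'a tangent"
type_synonym 'a form_field = "'a \<Rightarrow> 'a tangent \<Rightarrow> 'a tangent \<Rightarrow> real"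

definition ap :: "('a, 'e::euclidean_space) manifold \<Rightarrow> 'a endo_field \<Rightarrow> 'a vfield \<Rightarrow> 'a vfield" where
  "ap M J X = (\<lambda>p. if p \<in> points M then J p (X p) else 0)"

definition tensor_field_11 :: "('a, 'e::euclidean_space) manifold \<Rightarrow> 'a endo_field \<Rightarrow> bool" where
  "tensor_field_11 M J \<longleftrightarrow>
     (\<forall>p\<in>points M.
        (\<forall>v\<in>tangent_space M p. J p v \<in> tangent_space M p) \<and>
        (\<forall>v\<in>tangent_space M p. \<forall>w\<in>tangent_space M p. J p (v + w) = J p v + J p w) \<and>
        (\<forall>c. \<forall>v\<in>tangent_space M p. J p (scale c v) = scale c (J p v))) \<and>
     (\<forall>X\<in>vector_fields M. ap M J X \<in> vector_fields M)"

definition ev :: "'a form_field \<Rightarrow> 'a vfield \<Rightarrow> 'a vfield \<Rightarrow> 'a \<Rightarrow> real" where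
  "ev g X Y = (\<lambda>p. g p (X p) (Y p))"

text \<open>No condition on the signature beyond nondegeneracy; it is locally constant.\<close>

definition pseudo_Riemannian_metric ::
    "('a, 'e::euclidean_space) manifold \<Rightarrow> 'a form_field \<Rightarrow> bool" where
  "pseudo_Riemannian_metric M g \<longleftrightarrow>
     (\<forall>p\<in>points M.
        (\<forall>u\<in>tangent_space M p. \<forall>v\<in>tangent_space M p. \<forall>w\<in>tangent_space M p.
           g p (u + v) w = g p u w + g p v w) \<and>
        (\<forall>c. \<forall>v\<in>tangent_space M p. \<forall>w\<in>tangent_space M p. g p (scale c v) w = c * g p v w) \<and>
        (\<forall>v\<in>tangent_space M p. \<forall>w\<in>tangent_space M p. g p v w = g p w v) \<and>
        (\<forall>v\<in>tangent_space M p. (\<forall>w\<in>tangent_space M p. g p v w = 0) \<longrightarrow> v = 0)) \<and>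
     (\<forall>X\<in>vector_fields M. \<forall>Y\<in>vector_fields M. ev g X Y \<in> smooth_functions M)"


section \<open>Metallic pseudo-Riemannian manifolds\<close>

text \<open>A smooth bundle map that is a linear bijection on each fibre is a bundle isomorphism.\<close>

definition metallic_structure :: "('a, 'e::euclidean_space) manifold \<Rightarrow> 'a endo_field \<Rightarrow> bool" where
  "metallic_structure M J \<longleftrightarrow> tensor_field_11 M J \<and>
     (\<forall>p\<in>points M. bij_betw (J p) (tangent_space M p) (tangent_space M p)) \<and>
     (\<exists>a b. \<forall>p\<in>points M. \<forall>v\<in>tangent_space M p. J p (J p v) = scale a (J p v) + scale b v)"

definition metallic_pseudo_Riemannian_manifold ::
    "('a, 'e::euclidean_space) manifold \<Rightarrow> 'a endo_field \<Rightarrow> 'a form_field \<Rightarrow> bool" where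
  "metallic_pseudo_Riemannian_manifold M J g \<longleftrightarrow>
     smooth_manifold M \<and> pseudo_Riemannian_metric M g \<and> metallic_structure M J \<and>
     (\<forall>X\<in>vector_fields M. \<forall>Y\<in>vector_fields M. \<forall>p\<in>points M.
        ev g (ap M J X) Y p = ev g X (ap M J Y) p)"

definition nijenhuis ::
    "('a, 'e::euclidean_space) manifold \<Rightarrow> 'a endo_field \<Rightarrow> 'a vfield \<Rightarrow> 'a vfield \<Rightarrow> 'a vfield" where
  "nijenhuis M J X Y =
     bracket (ap M J X) (ap M J Y) - ap M J (bracket (ap M J X) Y) - ap M J (bracket X (ap M J Y))
       + ap M J (ap M J (bracket X Y))"

definition integrable_structure ::
    "('a, 'e::euclidean_space) manifold \<Rightarrow> 'a endo_field \<Rightarrow> bool" where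
  "integrable_structure M J \<longleftrightarrow>
     (\<forall>X\<in>vector_fields M. \<forall>Y\<in>vector_fields M. nijenhuis M J X Y = 0)"

text \<open>\<open>lie_deriv_endo M J X Y\<close> is \<open>(L\<^sub>X J) Y\<close>.\<close>

definition lie_deriv_endo ::
    "('a, 'e::euclidean_space) manifold \<Rightarrow> 'a endo_field \<Rightarrow> 'a vfield \<Rightarrow> 'a vfield \<Rightarrow> 'a vfield" where
  "lie_deriv_endo M J X Y = bracket X (ap M J Y) - ap M J (bracket X Y)"

definition tachibana ::
    "('a, 'e::euclidean_space) manifold \<Rightarrow> 'a endo_field \<Rightarrow> 'a form_field \<Rightarrow>
     'a vfield \<Rightarrow> 'a vfield \<Rightarrow> 'a vfield \<Rightarrow> 'a \<Rightarrow> real" where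
  "tachibana M J g X Y Z =
     dir_deriv (ap M J X) (ev g Y Z) - dir_deriv X (ev g (ap M J Y) Z)
       + ev g (lie_deriv_endo M J Y X) Z + ev g Y (lie_deriv_endo M J Z X)"

definition quasi_metallic_pseudo_Riemannian_manifold ::
    "('a, 'e::euclidean_space) manifold \<Rightarrow> 'a endo_field \<Rightarrow> 'a form_field \<Rightarrow> bool" where
  "quasi_metallic_pseudo_Riemannian_manifold M J g \<longleftrightarrow>
     metallic_pseudo_Riemannian_manifold M J g \<and> \<not> integrable_structure M J \<and>
     (\<forall>X\<in>vector_fields M. \<forall>Y\<in>vector_fields M. \<forall>Z\<in>vector_fields M. \<forall>p\<in>points M.
        tachibana M J g X Y Z p + tachibana M J g Y Z X p + tachibana M J g Z X Y p = 0)"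


section \<open>Linear connections\<close>

type_synonym 'a connection = "'a vfield \<Rightarrow> 'a vfield \<Rightarrow> 'a vfield"

definition linear_connection :: "('a, 'e::euclidean_space) manifold \<Rightarrow> 'a connection \<Rightarrow> bool" where
  "linear_connection M D \<longleftrightarrow>
     (\<forall>X\<in>vector_fields M. \<forall>Y\<in>vector_fields M. D X Y \<in> vector_fields M) \<and>
     (\<forall>X\<in>vector_fields M. \<forall>Y\<in>vector_fields M. \<forall>Z\<in>vector_fields M.
        D (X + Y) Z = D X Z + D Y Z \<and> D X (Y + Z) = D X Y + D X Z) \<and>
     (\<forall>f\<in>smooth_functions M. \<forall>X\<in>vector_fields M. \<forall>Y\<in>vector_fields M.
        D (fscale f X) Y = fscale f (D X Y) \<and>
        D X (fscale f Y) = fscale (dir_deriv X f) Y + fscale f (D X Y))"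

definition torsion_free :: "('a, 'e::euclidean_space) manifold \<Rightarrow> 'a connection \<Rightarrow> bool" where
  "torsion_free M D \<longleftrightarrow>
     (\<forall>X\<in>vector_fields M. \<forall>Y\<in>vector_fields M. D X Y - D Y X - bracket X Y = 0)"

text \<open>\<open>cov_deriv_endo M D J X Y\<close> is \<open>(\<nabla>\<^sub>X J) Y\<close> and \<open>cov_deriv_form D g X Y Z\<close> is
  \<open>(\<nabla>\<^sub>X g) (Y, Z)\<close>.\<close>

definition cov_deriv_endo ::
    "('a, 'e::euclidean_space) manifold \<Rightarrow> 'a connection \<Rightarrow> 'a endo_field \<Rightarrow>
     'a vfield \<Rightarrow> 'a vfield \<Rightarrow> 'a vfield" where
  "cov_deriv_endo M D J X Y = D X (ap M J Y) - ap M J (D X Y)"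

definition cov_deriv_form ::
    "'a connection \<Rightarrow> 'a form_field \<Rightarrow> 'a vfield \<Rightarrow> 'a vfield \<Rightarrow> 'a vfield \<Rightarrow> 'a \<Rightarrow> real" where
  "cov_deriv_form D g X Y Z = dir_deriv X (ev g Y Z) - ev g (D X Y) Z - ev g Y (D X Z)"

definition Codazzi_coupled ::
    "('a, 'e::euclidean_space) manifold \<Rightarrow> 'a connection \<Rightarrow> 'a form_field \<Rightarrow> bool" where
  "Codazzi_coupled M D g \<longleftrightarrow>
     (\<forall>X\<in>vector_fields M. \<forall>Y\<in>vector_fields M. \<forall>Z\<in>vector_fields M. \<forall>p\<in>points M.
        cov_deriv_form D g X Y Z p = cov_deriv_form D g Z X Y p)"

end

theory Submission
  imports Defs
begin

text \<open>
  Write \<open>A(X,Y,Z) = g((\<nabla>\<^sub>X J) Y, Z)\<close> and \<open>C(X,Y,Z) = (\<nabla>\<^sub>X g)(Y, Z)\<close>. Without torsion every Lie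
  bracket is a commutator of covariant derivatives, and the first derivatives of \<open>g\<close> are given by
  \<open>C\<close>. After this substitution the derivatives of the single fields cancel, by the symmetry of \<open>g\<close>
  and the \<open>g\<close>-symmetry of \<open>J\<close>, and the Tachibana operator becomes tensorial (lemma
  \<open>tachibana_eq_cov_deriv\<close>):
  \<open>(\<Phi>\<^sub>J g)(X,Y,Z) = C(JX,Y,Z) - C(X,JY,Z) - A(X,Y,Z) + A(Y,X,Z) + A(Z,X,Y)\<close>.

  In the cyclic sum over \<open>X, Y, Z\<close> the term \<open>C(JX,Y,Z)\<close> meets \<open>- C(Z,JX,Y)\<close>, which is its negative
  by the Codazzi condition; the other \<open>C\<close>-terms cancel in the same way. The terms \<open>- A(X,Y,Z)\<close>
  cancel against the cyclic shifts of \<open>A(Z,X,Y)\<close>. What is left are the shifts of \<open>A(Y,X,Z)\<close>, that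
  is, the cyclic sum of \<open>A\<close> at \<open>(X,Z,Y)\<close> (lemma \<open>cyclic_tachibana_eq\<close>). As \<open>X, Y, Z\<close> range over
  all vector fields, one cyclic sum vanishes identically if and only if the other does.
\<close>

lemma tangent_space_add:
  assumes "v \<in> tangent_space M p" "w \<in> tangent_space M p"
  shows "v + w \<in> tangent_space M p"
  using assms by (simp add: tangent_space_def algebra_simps)

lemma tangent_space_scale:
  assumes "v \<in> tangent_space M p"
  shows "scale c v \<in> tangent_space M p"
  using assms by (simp add: tangent_space_def scale_def algebra_simps)

lemma diff_eq_add_scale: "v - w = v + scale (-1) w"
  by (simp add: fun_eq_iff scale_def)

lemma tangent_space_diff:
  assumes "v \<in> tangent_space M p" "w \<in> tangent_space M p"
  shows "v - w \<in> tangent_space M p"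
  using assms by (simp add: diff_eq_add_scale tangent_space_add tangent_space_scale)

lemma tensor_field_11_diff:
  assumes "tensor_field_11 M J" "p \<in> points M" "v \<in> tangent_space M p" "w \<in> tangent_space M p"
  shows "J p (v - w) = J p v - J p w"
  using assms by (simp add: tensor_field_11_def diff_eq_add_scale tangent_space_scale)

lemma metric_commute:
  assumes "pseudo_Riemannian_metric M g" "p \<in> points M"
    "v \<in> tangent_space M p" "w \<in> tangent_space M p"
  shows "g p v w = g p w v"
  using assms by (simp add: pseudo_Riemannian_metric_def)

lemma metric_add_left:
  assumes "pseudo_Riemannian_metric M g" "p \<in> points M"
    "u \<in> tangent_space M p" "v \<in> tangent_space M p" "w \<in> tangent_space M p"
  shows "g p (u + v) w = g p u w + g p v w"
  using assms by (simp add: pseudo_Riemannian_metric_def)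

lemma metric_scale_left:
  assumes "pseudo_Riemannian_metric M g" "p \<in> points M"
    "v \<in> tangent_space M p" "w \<in> tangent_space M p"
  shows "g p (scale c v) w = c * g p v w"
  using assms unfolding pseudo_Riemannian_metric_def by blast

lemma metric_diff_left:
  assumes "pseudo_Riemannian_metric M g" "p \<in> points M"
    "u \<in> tangent_space M p" "v \<in> tangent_space M p" "w \<in> tangent_space M p"
  shows "g p (u - v) w = g p u w - g p v w"
  using assms
  by (simp add: diff_eq_add_scale metric_add_left metric_scale_left tangent_space_scale)

lemma torsion_free_bracket:
  assumes "torsion_free M D" "X \<in> vector_fields M" "Y \<in> vector_fields M"
  shows "bracket X Y = D X Y - D Y X"
  using assms by (simp add: torsion_free_def)

text \<open>Expanding both brackets in \<open>[Y, JX] - J[Y, X]\<close> gives four covariant derivatives; the two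
  along \<open>Y\<close> combine to the tensorial part \<open>(\<nabla>\<^sub>Y J) X\<close>.\<close>

lemma lie_deriv_endo_torsion_free:
  assumes J: "tensor_field_11 M J" and D: "linear_connection M D" and tf: "torsion_free M D"
    and X: "X \<in> vector_fields M" and Y: "Y \<in> vector_fields M" and p: "p \<in> points M"
  shows "lie_deriv_endo M J Y X p =
    cov_deriv_endo M D J Y X p - D (ap M J X) Y p + ap M J (D X Y) p"
proof -
  have JX: "ap M J X \<in> vector_fields M"
    using J X by (simp add: tensor_field_11_def)
  have T: "D X Y p \<in> tangent_space M p" "D Y X p \<in> tangent_space M p"
    using D X Y p by (simp_all add: linear_connection_def vector_fields_def)
  show ?thesis
    using p by (simp add: lie_deriv_endo_def cov_deriv_endo_def ap_def[of M J "D Y X - D X Y"]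
        ap_def[of M J "D Y X"] ap_def[of M J "D X Y"] torsion_free_bracket[OF tf Y JX]
        torsion_free_bracket[OF tf Y X] tensor_field_11_diff[OF J p T(2,1)])
qed

text \<open>Substituting \<open>C\<close> for the derivatives of \<open>g\<close>, the terms \<open>g(\<nabla>\<^bsub>JX\<^esub> Y, Z)\<close> and
  \<open>g(Y, \<nabla>\<^bsub>JX\<^esub> Z)\<close> cancel against the Lie derivatives, and so does \<open>g(J \<nabla>\<^sub>X Y, Z)\<close>; the
  \<open>g\<close>-symmetry of \<open>J\<close> serves to cancel \<open>g(JY, \<nabla>\<^sub>X Z)\<close> against \<open>g(Y, J \<nabla>\<^sub>X Z)\<close>.\<close>

lemma tachibana_eq_cov_deriv:
  assumes m: "metallic_pseudo_Riemannian_manifold M J g"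
    and D: "linear_connection M D" and tf: "torsion_free M D"
    and X: "X \<in> vector_fields M" and Y: "Y \<in> vector_fields M" and Z: "Z \<in> vector_fields M"
    and p: "p \<in> points M"
  shows "tachibana M J g X Y Z p =
    cov_deriv_form D g (ap M J X) Y Z p - cov_deriv_form D g X (ap M J Y) Z p
      - ev g (cov_deriv_endo M D J X Y) Z p + ev g (cov_deriv_endo M D J Y X) Z p
      + ev g (cov_deriv_endo M D J Z X) Y p"
proof -
  have J: "tensor_field_11 M J" and g: "pseudo_Riemannian_metric M g"
    using m by (simp_all add: metallic_pseudo_Riemannian_manifold_def metallic_structure_def)
  have vf: "W p \<in> tangent_space M p" if "W \<in> vector_fields M" for W
    using that p by (simp add: vector_fields_def)
  have JV: "ap M J W \<in> vector_fields M" if "W \<in> vector_fields M" for W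
    using J that by (simp add: tensor_field_11_def)
  have DV: "D V W \<in> vector_fields M" if "V \<in> vector_fields M" "W \<in> vector_fields M" for V W
    using D that by (simp add: linear_connection_def)
  note VF = X Y Z
  have cov: "cov_deriv_endo M D J V W p \<in> tangent_space M p"
    if "V \<in> vector_fields M" "W \<in> vector_fields M" for V W
    using that by (simp add: cov_deriv_endo_def tangent_space_diff vf JV DV)
  have lie: "ev g (lie_deriv_endo M J V X) W p =
      ev g (cov_deriv_endo M D J V X) W p - ev g (D (ap M J X) V) W p + ev g (ap M J (D X V)) W p"
    if "V \<in> vector_fields M" "W \<in> vector_fields M" for V W
    using that X
    by (simp add: ev_def lie_deriv_endo_torsion_free[OF J D tf X _ p] metric_add_left[OF g p]
        metric_diff_left[OF g p] cov vf JV DV tangent_space_diff)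
  have lie_in: "lie_deriv_endo M J Z X p \<in> tangent_space M p"
    using VF by (simp add: lie_deriv_endo_torsion_free[OF J D tf _ _ p] cov vf JV DV
        tangent_space_diff tangent_space_add)
  have comm: "ev g V W p = ev g W V p"
    if "V p \<in> tangent_space M p" "W p \<in> tangent_space M p" for V W
    using that by (simp add: ev_def metric_commute[OF g p])
  have nabla_J: "ev g (D X (ap M J Y)) Z p =
      ev g (cov_deriv_endo M D J X Y) Z p + ev g (ap M J (D X Y)) Z p"
    using VF by (simp add: ev_def cov_deriv_endo_def metric_diff_left[OF g p] vf JV DV)
  have J_sym: "ev g (ap M J Y) (D X Z) p = ev g (ap M J (D X Z)) Y p"
    using m VF p
      comm[of Y "ap M J (D X Z)", OF vf[OF Y] vf[OF JV[OF DV[OF X Z]]]]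
    by (simp add: metallic_pseudo_Riemannian_manifold_def DV)
  have D_comm: "ev g Y (D (ap M J X) Z) p = ev g (D (ap M J X) Z) Y p"
    by (intro comm vf DV JV VF)
  show ?thesis
    using lie[OF Y Z] lie[OF Z Y] nabla_J J_sym D_comm
      comm[of Y "lie_deriv_endo M J Z X", OF vf[OF Y] lie_in]
    by (simp add: tachibana_def cov_deriv_form_def)
qed

lemma cyclic_tachibana_eq:
  assumes m: "metallic_pseudo_Riemannian_manifold M J g"
    and D: "linear_connection M D" and tf: "torsion_free M D" and c: "Codazzi_coupled M D g"
    and X: "X \<in> vector_fields M" and Y: "Y \<in> vector_fields M" and Z: "Z \<in> vector_fields M"
    and p: "p \<in> points M"
  shows "tachibana M J g X Y Z p + tachibana M J g Y Z X p + tachibana M J g Z X Y p =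
    ev g (cov_deriv_endo M D J X Z) Y p + ev g (cov_deriv_endo M D J Z Y) X p
      + ev g (cov_deriv_endo M D J Y X) Z p"
proof -
  have cod: "cov_deriv_form D g (ap M J U) V W p = cov_deriv_form D g W (ap M J U) V p"
    if "U \<in> vector_fields M" "V \<in> vector_fields M" "W \<in> vector_fields M" for U V W
    using m c that p
    by (simp add: Codazzi_coupled_def metallic_pseudo_Riemannian_manifold_def
        metallic_structure_def tensor_field_11_def)
  show ?thesis
    using cod[OF X Y Z] cod[OF Y Z X] cod[OF Z X Y]
    by (simp add: tachibana_eq_cov_deriv[OF m D tf _ _ _ p] X Y Z)
qed

theorem corollary1:
  fixes M :: "('a, 'e::euclidean_space) manifold"
    and J :: "'a endo_field" and g :: "'a form_field" and D :: "'a connection"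
  assumes "metallic_pseudo_Riemannian_manifold M J g"
    and "\<not> integrable_structure M J"
    and "linear_connection M D"
    and "torsion_free M D"
    and "Codazzi_coupled M D g"
  shows "quasi_metallic_pseudo_Riemannian_manifold M J g \<longleftrightarrow>
    (\<forall>X\<in>vector_fields M. \<forall>Y\<in>vector_fields M. \<forall>Z\<in>vector_fields M. \<forall>p\<in>points M.
       ev g (cov_deriv_endo M D J X Y) Z p + ev g (cov_deriv_endo M D J Y Z) X p
         + ev g (cov_deriv_endo M D J Z X) Y p = 0)"
proof -
  have "quasi_metallic_pseudo_Riemannian_manifold M J g \<longleftrightarrow>
    (\<forall>X\<in>vector_fields M. \<forall>Y\<in>vector_fields M. \<forall>Z\<in>vector_fields M. \<forall>p\<in>points M.
       ev g (cov_deriv_endo M D J X Z) Y p + ev g (cov_deriv_endo M D J Z Y) X p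
         + ev g (cov_deriv_endo M D J Y X) Z p = 0)"
    using assms(1,2)
    by (simp add: quasi_metallic_pseudo_Riemannian_manifold_def
        cyclic_tachibana_eq[OF assms(1,3-5)])
  then show ?thesis by blast
qed

end
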